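(* Let $\mu$ be a Borel, locally finite measure on $\mathbb{R}^N$ with support $K$, absolutely friendly with constants $r_0,C,D,a>0$, and set $\alpha'=(D/C)^{1/a}$. Let $\Omega=K$. Let $\mathcal{U}=\{U_j\subset\mathbb{R}^N: j\in\mathbb{N}\}$ be a family of subsets of $\mathbb{R}^N$, let $I:\mathbb{N}\to\mathbb{R}^+$ be increasing with $I(j)\to\infty$ as $j\to\infty$, and let $\rho:\mathbb{R}^+\to\mathbb{R}^+$ satisfy $\rho(r)\to0$ as $r\to\infty$ and be decreasing for large enough $r$. Let $F:\mathbb{N}\to\mathbb{R}^+$ be increasing with $F(k)\to\infty$ as $k\to\infty$, and define $F^0=[0,F(0))$ and $F^k=[F(k-1),F(k))$ for $k>0$. Suppose $0<\beta<1$ and $0<\alpha<\frac{1}{12}\alpha'$ satisfy: (1) for every $k,l\in\mathbb{N}$, every $\mathbf{x}\in K$ and every $r\le r_0$, if $I(j_1),\dots,I(j_l)\in F^k$ then $\big(\bigcup_{i=1}^l U_{j_i}\big)\cap B(\mathbf{x},(\alpha\beta)^k r)\subset\mathcal{L}$ for some affine hyperplane $\mathcal{L}$; (2) for every $k$, $(\alpha\beta)^k\ge\rho(F(k))$. Then $\mathbf{Bad}^*(\mathcal{U},I,\rho,\Omega)$ is an $(\alpha,\beta)$-winning set on $\Omega$.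
   Context: $B(\mathbf{x},r)$ denotes the closed Euclidean ball; for an affine hyperplane $\mathcal{L}$ and $\epsilon\ge0$, $\mathcal{L}^{(\epsilon)}=\{\mathbf{x}: d(\mathbf{x},\mathcal{L})\le\epsilon\}$; $d(A,B)$ is the infimum of distances between points of $A$ and $B$. A measure $\mu$ on $\mathbb{R}^N$ with support $K$ is absolutely friendly with constants $r_0,C,D,a>0$ if for every $0<r\le r_0$ and every $\mathbf{x}\in K$: (i) for any $0\le\epsilon\le r$ and any affine hyperplane $\mathcal{L}$, $\mu(B(\mathbf{x},r)\cap\mathcal{L}^{(\epsilon)})<C(\epsilon/r)^a\mu(B(\mathbf{x},r))$; (ii) $\mu(B(\mathbf{x},\frac56r))>D\mu(B(\mathbf{x},r))$. $\mathbf{Bad}^*(\mathcal{U},I,\rho,\Omega)=\{\mathbf{x}\in\Omega:\exists\delta>0\text{ such that } d(\mathbf{x},U_j)\ge\delta\rho(I(j))\ \forall j\in\mathbb{N}\}$. Schmidt's game on a complete metric space $(X,d)$ with target set $S\subset X$ and parameters $0<\alpha,\beta<1$: player B chooses a closed ball $B_0=B(y_0,r)$ ($y_0\in X$, $r>0$); then A chooses $A_0=B(x_0,\alpha r)\subset B_0$, then B chooses $B_1=B(y_1,\alpha\beta r)\subset A_0$, and so on, giving nested closed balls $B_0\supset A_0\supset B_1\supset A_1\supset\cdots$ with $B_k$ of radius $(\alpha\beta)^k r$ and $A_k$ of radius $\alpha(\alpha\beta)^k r$, all centers in $X$; their intersection is a single point $z$, and A wins if $z\in S$. $S$ is $(\alpha,\beta)$-winning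 if A has a strategy that wins regardless of B's moves. Here the game is played on the metric space $(K,d)$ with $d$ Euclidean. *)

theory Defs
  imports "HOL-Analysis.Analysis"
begin

section \<open>Distances, hyperplanes and measures\<close>

text \<open>
  The distance is extended-real valued because \<^const>\<open>setdist\<close> and \<^const>\<open>infdist\<close> are 0 when one
  of the sets is empty, whereas the infimum over no pairs of points is infinity.
\<close>

definition set_dist :: "'a::metric_space set \<Rightarrow> 'a set \<Rightarrow> ereal" where
  "set_dist A B = (INF a\<in>A. INF b\<in>B. ereal (dist a b))"

definition affine_hyperplane :: "'a::euclidean_space set \<Rightarrow> bool" where
  "affine_hyperplane L \<longleftrightarrow> (\<exists>a b. a \<noteq> 0 \<and> L = {x. a \<bullet> x = b})"

definition closed_nbhd :: "'a::metric_space set \<Rightarrow> real \<Rightarrow> 'a set" where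
  "closed_nbhd L \<epsilon> = {x. set_dist {x} L \<le> ereal \<epsilon>}"

definition locally_finite_measure :: "'a::topological_space measure \<Rightarrow> bool" where
  "locally_finite_measure \<mu> \<longleftrightarrow> (\<forall>x. \<exists>V. open V \<and> x \<in> V \<and> emeasure \<mu> V < \<infinity>)"

definition measure_support :: "'a::topological_space measure \<Rightarrow> 'a set" where
  "measure_support \<mu> = {x. \<forall>V. open V \<longrightarrow> x \<in> V \<longrightarrow> emeasure \<mu> V > 0}"

text \<open>
  The hyperplane condition is often written with a strict inequality. For \<open>\<epsilon> = 0\<close> its right-hand side
  is 0, so a strict inequality could never hold; it is therefore stated with \<open>\<le>\<close>. Given the
  strict inequality for \<open>0 < \<epsilon> \<le> r\<close>, the case \<open>\<epsilon> = 0\<close> follows by letting \<open>\<epsilon>\<close> tend to 0 (for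
  locally finite measures), so the notion below is also implied by that variant.
\<close>

definition absolutely_friendly ::
    "'a::euclidean_space measure \<Rightarrow> real \<Rightarrow> real \<Rightarrow> real \<Rightarrow> real \<Rightarrow> bool" where
  "absolutely_friendly \<mu> r0 C D a \<longleftrightarrow>
     r0 > 0 \<and> C > 0 \<and> D > 0 \<and> a > 0 \<and>
     (\<forall>r x. 0 < r \<longrightarrow> r \<le> r0 \<longrightarrow> x \<in> measure_support \<mu> \<longrightarrow>
        (\<forall>\<epsilon> L. 0 \<le> \<epsilon> \<longrightarrow> \<epsilon> \<le> r \<longrightarrow> affine_hyperplane L \<longrightarrow>
           emeasure \<mu> (cball x r \<inter> closed_nbhd L \<epsilon>)
             \<le> ennreal (C * (\<epsilon> / r) powr a) * emeasure \<mu> (cball x r)) \<and>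
        emeasure \<mu> (cball x (5 / 6 * r)) > ennreal D * emeasure \<mu> (cball x r))"


section \<open>The badly approximable set\<close>

definition Bad_star ::
    "(nat \<Rightarrow> 'a::metric_space set) \<Rightarrow> (nat \<Rightarrow> real) \<Rightarrow> (real \<Rightarrow> real) \<Rightarrow> 'a set \<Rightarrow> 'a set" where
  "Bad_star U I \<rho> \<Omega> =
     {x\<in>\<Omega>. \<exists>\<delta>>0. \<forall>j. set_dist {x} (U j) \<ge> ereal (\<delta> * \<rho> (I j))}"

definition F_block :: "(nat \<Rightarrow> real) \<Rightarrow> nat \<Rightarrow> real set" where
  "F_block F k = (if k = 0 then {0..<F 0} else {F (k - 1)..<F k})"


section \<open>Schmidt's game\<close>

text \<open>
  A run is recorded by the radius \<open>r\<close> of \<open>B\<^sub>0\<close> and the sequences \<open>y\<close>, \<open>x\<close> of centres chosen by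
  B and A; the radii of all later balls are forced. Inclusion of balls means inclusion as
  subsets of the metric space.
\<close>

context Metric_space
begin

definition B_ball :: "real \<Rightarrow> real \<Rightarrow> real \<Rightarrow> (nat \<Rightarrow> 'a) \<Rightarrow> nat \<Rightarrow> 'a set" where
  "B_ball \<alpha> \<beta> r y k = mcball (y k) ((\<alpha> * \<beta>) ^ k * r)"

definition A_ball :: "real \<Rightarrow> real \<Rightarrow> real \<Rightarrow> (nat \<Rightarrow> 'a) \<Rightarrow> nat \<Rightarrow> 'a set" where
  "A_ball \<alpha> \<beta> r x k = mcball (x k) (\<alpha> * (\<alpha> * \<beta>) ^ k * r)"

definition B_legal :: "real \<Rightarrow> real \<Rightarrow> real \<Rightarrow> (nat \<Rightarrow> 'a) \<Rightarrow> (nat \<Rightarrow> 'a) \<Rightarrow> nat \<Rightarrow> bool" where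
  "B_legal \<alpha> \<beta> r y x k \<longleftrightarrow>
     y k \<in> M \<and> (k > 0 \<longrightarrow> B_ball \<alpha> \<beta> r y k \<subseteq> A_ball \<alpha> \<beta> r x (k - 1))"

definition A_legal :: "real \<Rightarrow> real \<Rightarrow> real \<Rightarrow> (nat \<Rightarrow> 'a) \<Rightarrow> (nat \<Rightarrow> 'a) \<Rightarrow> nat \<Rightarrow> bool" where
  "A_legal \<alpha> \<beta> r y x k \<longleftrightarrow>
     x k \<in> M \<and> A_ball \<alpha> \<beta> r x k \<subseteq> B_ball \<alpha> \<beta> r y k"

text \<open>
  A strategy for A maps the initial radius and the list of all centres chosen so far by B to A's next
  centre; A's own earlier moves are determined by these data. A winning strategy must answer
  legally as long as B has played legally, and win every run in which B always plays legally.
\<close>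

definition A_response :: "(real \<Rightarrow> 'a list \<Rightarrow> 'a) \<Rightarrow> real \<Rightarrow> (nat \<Rightarrow> 'a) \<Rightarrow> nat \<Rightarrow> 'a" where
  "A_response \<sigma> r y k = \<sigma> r (map y [0..<Suc k])"

definition winning_strategy ::
    "real \<Rightarrow> real \<Rightarrow> 'a set \<Rightarrow> (real \<Rightarrow> 'a list \<Rightarrow> 'a) \<Rightarrow> bool" where
  "winning_strategy \<alpha> \<beta> S \<sigma> \<longleftrightarrow>
     (\<forall>r>0. \<forall>y.
        (\<forall>k. (\<forall>i\<le>k. B_legal \<alpha> \<beta> r y (A_response \<sigma> r y) i)
               \<longrightarrow> A_legal \<alpha> \<beta> r y (A_response \<sigma> r y) k) \<and>
        ((\<forall>k. B_legal \<alpha> \<beta> r y (A_response \<sigma> r y) k)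
               \<longrightarrow> (\<exists>z\<in>S. (\<Inter>k. B_ball \<alpha> \<beta> r y k) = {z})))"

definition schmidt_winning :: "real \<Rightarrow> real \<Rightarrow> 'a set \<Rightarrow> bool" where
  "schmidt_winning \<alpha> \<beta> S \<longleftrightarrow> S \<subseteq> M \<and> (\<exists>\<sigma>. winning_strategy \<alpha> \<beta> S \<sigma>)"

end

end

(*
  Friendliness forces D < C, and it provides, in the ball of radius 5s/6 around any point of K, a
  point of K at distance more than ((D/C)^(1/a)) s > 12 alpha s from any given hyperplane: the
  neighbourhood of the hyperplane has less mass than the smaller ball. When B's ball has radius s,
  A centres the answer at such a point for the hyperplane that contains the current block of the
  U_j; since s - 5s/6 = s/6 >= 2 alpha s, A's ball stays at distance at least alpha s from the block, also
  from the parts of the U_j outside B's ball. As rho (I j) is at most (alpha beta)^(k-1) on the k-th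
  block once k is large, one delta works for all but finitely many j, and shrinking it handles the rest.
*)
theory Submission
  imports Defs
begin

section \<open>Neighbourhoods of affine hyperplanes\<close>

lemma set_dist_singleton: "set_dist {x} L = (INF b\<in>L. ereal (dist x b))"
  by (simp add: set_dist_def)

lemma closed_nbhd_conv_infdist:
  assumes "L \<noteq> {}"
  shows "closed_nbhd L \<epsilon> = {x. infdist x L \<le> \<epsilon>}"
proof -
  have "set_dist {x} L = ereal (infdist x L)" for x
  proof -
    obtain b where b: "b \<in> L"
      using assms by blast
    have "(INF b\<in>L. ereal (dist x b)) \<le> ereal (dist x b)" "0 \<le> (INF b\<in>L. ereal (dist x b))"
      using b by (auto intro: INF_lower INF_greatest)
    then have "\<bar>INF b\<in>L. ereal (dist x b)\<bar> \<noteq> \<infinity>"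
      by auto
    then show ?thesis
      unfolding set_dist_singleton infdist_notempty[OF assms] by (rule ereal_INF[symmetric])
  qed
  then show ?thesis
    by (simp add: closed_nbhd_def)
qed

lemma closed_closed_nbhd: "L \<noteq> {} \<Longrightarrow> closed (closed_nbhd L \<epsilon>)"
  by (simp add: closed_nbhd_conv_infdist closed_Collect_le continuous_on_infdist)

lemma dist_gt_if_notin_closed_nbhd:
  assumes "x \<notin> closed_nbhd L \<epsilon>" "p \<in> L"
  shows "\<epsilon> < dist x p"
proof -
  have "ereal \<epsilon> < (INF b\<in>L. ereal (dist x b))"
    using assms(1) by (simp add: closed_nbhd_def set_dist_singleton not_le)
  also have "\<dots> \<le> ereal (dist x p)"
    using assms(2) by (rule INF_lower)
  finally show ?thesis
    by simp
qed

lemma affine_hyperplane_nonempty: "affine_hyperplane L \<Longrightarrow> L \<noteq> {}"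
proof -
  assume "affine_hyperplane L"
  then obtain a b where ab: "a \<noteq> 0" "L = {x. a \<bullet> x = b}"
    by (auto simp: affine_hyperplane_def)
  then have "(b / (a \<bullet> a)) *\<^sub>R a \<in> L"
    by simp
  then show ?thesis
    by blast
qed

lemma affine_hyperplane_through:
  fixes x :: "'a::euclidean_space"
  obtains L where "affine_hyperplane L" "x \<in> L"
proof -
  obtain a :: 'a where "a \<in> Basis"
    using nonempty_Basis by blast
  then have "affine_hyperplane {z. a \<bullet> z = a \<bullet> x}"
    unfolding affine_hyperplane_def using nonzero_Basis by blast
  then show thesis
    by (rule that) simp
qed

section \<open>The support of a Borel measure\<close>

lemma closed_measure_support: "closed (measure_support \<mu>)"
  unfolding closed_def
proof (subst open_subopen, intro ballI)
  fix x assume "x \<in> - measure_support \<mu>"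
  then obtain V where "open V" "x \<in> V" "\<not> emeasure \<mu> V > 0"
    by (auto simp: measure_support_def)
  then show "\<exists>T. open T \<and> x \<in> T \<and> T \<subseteq> - measure_support \<mu>"
    by (intro exI[of _ V]) (auto simp: measure_support_def)
qed

text \<open>The complement is the union of all open null sets, and Lindelof's theorem replaces this
  family by a countable one. This lets a mass estimate see only the points of the support.\<close>

lemma Compl_measure_support_null:
  fixes \<mu> :: "'a::second_countable_topology measure"
  assumes borel: "sets \<mu> = sets borel"
  shows "- measure_support \<mu> \<in> null_sets \<mu>"
proof -
  define \<V> where "\<V> = {V :: 'a set. open V \<and> emeasure \<mu> V = 0}"
  obtain \<W> where \<W>: "\<W> \<subseteq> \<V>" "countable \<W>" "\<Union>\<W> = \<Union>\<V>"
    by (rule Lindelof[of \<V>]) (auto simp: \<V>_def)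
  have "- measure_support \<mu> = \<Union>\<V>"
    by (auto simp: measure_support_def \<V>_def)
  also have "\<dots> = (\<Union>V\<in>\<W>. V)"
    using \<W>(3) by simp
  also have "\<dots> \<in> null_sets \<mu>"
    using \<W>(1,2) borel by (intro null_sets_UN') (auto simp: \<V>_def null_sets_def)
  finally show ?thesis .
qed

section \<open>Consequences of absolute friendliness\<close>

lemma absolutely_friendlyD:
  assumes "absolutely_friendly \<mu> r0 C D a" "0 < r" "r \<le> r0" "x \<in> measure_support \<mu>"
  shows "\<lbrakk>0 \<le> \<epsilon>; \<epsilon> \<le> r; affine_hyperplane L\<rbrakk> \<Longrightarrow> emeasure \<mu> (cball x r \<inter> closed_nbhd L \<epsilon>)
             \<le> ennreal (C * (\<epsilon> / r) powr a) * emeasure \<mu> (cball x r)"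
    and "ennreal D * emeasure \<mu> (cball x r) < emeasure \<mu> (cball x (5 / 6 * r))"
  using assms unfolding absolutely_friendly_def by blast+

text \<open>For a hyperplane through \<open>x\<close> and width \<open>r0\<close>, the neighbourhood
  swallows the whole ball of radius \<open>r0\<close>, so the two friendliness bounds compare
  \<open>D\<close> and \<open>C\<close> times the same mass. The result makes
  \<open>(D / C) powr (1 / a) * s\<close> an admissible width in a ball of radius
  \<open>s\<close>.\<close>

lemma absolutely_friendly_consts_less:
  assumes borel: "sets \<mu> = sets borel"
    and friendly: "absolutely_friendly \<mu> r0 C D a"
    and x: "x \<in> measure_support \<mu>"
  shows "D < C"
proof -
  have pos: "r0 > 0" "C > 0" "D > 0" "a > 0"
    using friendly by (auto simp: absolutely_friendly_def)
  obtain L where L: "affine_hyperplane L" "x \<in> L"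
    by (rule affine_hyperplane_through)
  have sub: "cball x r0 \<subseteq> closed_nbhd L r0"
    using L(2) by (subst closed_nbhd_conv_infdist) (auto simp: dist_commute intro: infdist_le2)
  have "ennreal D * emeasure \<mu> (cball x r0) < emeasure \<mu> (cball x (5 / 6 * r0))"
    using absolutely_friendlyD(2)[OF friendly _ _ x] pos(1) by simp
  also have "\<dots> \<le> emeasure \<mu> (cball x r0 \<inter> closed_nbhd L r0)"
    using sub pos(1) borel closed_closed_nbhd[OF affine_hyperplane_nonempty[OF L(1)]]
    by (intro emeasure_mono) (auto intro!: sets.Int)
  also have "\<dots> \<le> ennreal (C * (r0 / r0) powr a) * emeasure \<mu> (cball x r0)"
    using pos(1) L(1) by (intro absolutely_friendlyD(1)[OF friendly _ _ x]) auto
  finally have "ennreal D * emeasure \<mu> (cball x r0) < ennreal C * emeasure \<mu> (cball x r0)"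
    using pos(1) by simp
  then show ?thesis
    using mult_right_mono[OF ennreal_leI, of C D "emeasure \<mu> (cball x r0)"] by (simp flip: not_le) blast
qed

lemma exists_support_point_off_hyperplane:
  assumes borel: "sets \<mu> = sets borel"
    and friendly: "absolutely_friendly \<mu> r0 C D a"
    and y: "y \<in> measure_support \<mu>"
    and s: "0 < s" "s \<le> r0"
    and L: "affine_hyperplane L"
  shows "\<exists>x\<in>measure_support \<mu> \<inter> cball y (5 / 6 * s). x \<notin> closed_nbhd L ((D / C) powr (1 / a) * s)"
proof (rule ccontr)
  define t where "t = (D / C) powr (1 / a)"
  have pos: "C > 0" "D > 0" "a > 0"
    using friendly by (auto simp: absolutely_friendly_def)
  have t: "0 \<le> t" "t \<le> 1"
    using pos absolutely_friendly_consts_less[OF borel friendly y]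
    by (auto simp: t_def intro!: powr_le1)
  \<comment> \<open>The width \<open>t * s\<close> is the one at which the upper bound for the
    neighbourhood carries exactly the factor \<open>D\<close> of the lower bound for the smaller
    ball.\<close>
  have ta: "C * (t * s / s) powr a = D"
    using pos s(1) by (simp add: t_def powr_powr)
  define N where "N = closed_nbhd L (t * s)"
  have N: "cball y s \<inter> N \<in> sets \<mu>"
    using borel closed_closed_nbhd[OF affine_hyperplane_nonempty[OF L]]
    by (auto simp: N_def intro!: sets.Int)
  assume "\<not> ?thesis"
  \<comment> \<open>Up to a null set the smaller ball would lie in the neighbourhood, and the chain
    below then bounds its mass strictly by itself.\<close>
  then have "cball y (5 / 6 * s) \<subseteq> (cball y s \<inter> N) \<union> - measure_support \<mu>"
    using s(1) by (auto simp: N_def t_def)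
  then have "emeasure \<mu> (cball y (5 / 6 * s)) \<le> emeasure \<mu> ((cball y s \<inter> N) \<union> - measure_support \<mu>)"
    using N Compl_measure_support_null[OF borel] by (intro emeasure_mono) (auto simp: null_sets_def)
  also have "\<dots> = emeasure \<mu> (cball y s \<inter> N)"
    by (rule emeasure_Un_null_set[OF N Compl_measure_support_null[OF borel]])
  also have "\<dots> \<le> ennreal (C * (t * s / s) powr a) * emeasure \<mu> (cball y s)"
    unfolding N_def using s t L mult_right_mono[OF t(2), of s]
    by (intro absolutely_friendlyD(1)[OF friendly s y]) auto
  also have "\<dots> < emeasure \<mu> (cball y (5 / 6 * s))"
    unfolding ta by (rule absolutely_friendlyD(2)[OF friendly s y])
  finally show False
    by simp
qed

lemma exists_ball_avoiding_hyperplane: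
  assumes borel: "sets \<mu> = sets borel"
    and friendly: "absolutely_friendly \<mu> r0 C D a"
    and \<alpha>: "0 < \<alpha>" "\<alpha> < 1 / 12 * (D / C) powr (1 / a)" "\<alpha> \<le> 1 / 12"
    and y: "y \<in> measure_support \<mu>"
    and s: "0 < s" "s \<le> r0"
    and L: "affine_hyperplane L" "V \<inter> cball y s \<subseteq> L"
  shows "\<exists>x\<in>measure_support \<mu>. cball x (\<alpha> * s) \<subseteq> cball y s \<and>
           (\<forall>p\<in>cball x (\<alpha> * s). \<forall>u\<in>V. \<alpha> * s \<le> dist p u)"
proof -
  obtain x where x: "x \<in> measure_support \<mu>" "dist y x \<le> 5 / 6 * s"
    and xL: "x \<notin> closed_nbhd L ((D / C) powr (1 / a) * s)"
    using exists_support_point_off_hyperplane[OF borel friendly y s L(1)] by auto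
  have \<alpha>s: "0 < \<alpha> * s" "\<alpha> * s \<le> 1 / 12 * s" "12 * (\<alpha> * s) \<le> (D / C) powr (1 / a) * s"
    using \<alpha> s mult_right_mono[of "12 * \<alpha>" "(D / C) powr (1 / a)" s] by auto
  \<comment> \<open>Here 11/12 is 5/6 + 1/12, which leaves a margin of \<open>s / 12\<close> up to
    the boundary of the ball around \<open>y\<close>.\<close>
  have close: "dist y p \<le> 11 / 12 * s" if "p \<in> cball x (\<alpha> * s)" for p
    using that x(2) \<alpha>s dist_triangle[of y p x] by simp
  have "\<alpha> * s \<le> dist p u" if p: "p \<in> cball x (\<alpha> * s)" and u: "u \<in> V" for p u
  \<comment> \<open>Inside the ball \<open>u\<close> lies on \<open>L\<close>, more than
    \<open>12 * (\<alpha> * s)\<close> from \<open>x\<close>, and moving from \<open>x\<close> to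
    \<open>p\<close> costs at most \<open>\<alpha> * s\<close>. Outside it the margin
    \<open>s / 12\<close> suffices.\<close>
  proof (cases "u \<in> cball y s")
    case True
    then have "u \<in> L"
      using L(2) u by blast
    then have "(D / C) powr (1 / a) * s < dist x u"
      using dist_gt_if_notin_closed_nbhd[OF xL] by blast
    then show ?thesis
      using p \<alpha>s(1,3) dist_triangle[of x u p] unfolding mem_cball by linarith
  next
    case False
    then show ?thesis
      using close[OF p] \<alpha>s dist_triangle[of y u p] by simp
  qed
  moreover have "cball x (\<alpha> * s) \<subseteq> cball y s"
    using close s(1) by force
  ultimately show ?thesis
    using x(1) by blast
qed

section \<open>Strategies in Schmidt's game\<close>

lemma (in Metric_space) schmidt_winning_empty: "M = {} \<Longrightarrow> schmidt_winning \<alpha> \<beta> {}"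
  unfolding schmidt_winning_def winning_strategy_def B_legal_def by blast

text \<open>A memoryless strategy is enough: \<open>Q\<close> is what A secures at turn
  \<open>k\<close>, and it can be secured from any current centre of B, so a choice function for the
  responses is already a strategy.\<close>

lemma (in Metric_space) schmidt_winning_if_responses:
  assumes complete: mcomplete and S: "S \<subseteq> M"
    and pos: "0 < \<alpha>" "0 < \<beta>" and less: "\<alpha> * \<beta> < 1"
    and response: "\<And>r k y. r > 0 \<Longrightarrow> y \<in> M \<Longrightarrow>
      \<exists>x\<in>M. mcball x (\<alpha> * (\<alpha> * \<beta>) ^ k * r) \<subseteq> mcball y ((\<alpha> * \<beta>) ^ k * r) \<and> Q r k x"
    and win: "\<And>r x z. r > 0 \<Longrightarrow> z \<in> M \<Longrightarrow>
      (\<And>k. z \<in> mcball (x k) (\<alpha> * (\<alpha> * \<beta>) ^ k * r)) \<Longrightarrow> (\<And>k. Q r k (x k)) \<Longrightarrow> z \<in> S"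
  shows "schmidt_winning \<alpha> \<beta> S"
proof -
  have "\<forall>r k y. \<exists>x. r > 0 \<longrightarrow> y \<in> M \<longrightarrow>
      x \<in> M \<and> mcball x (\<alpha> * (\<alpha> * \<beta>) ^ k * r) \<subseteq> mcball y ((\<alpha> * \<beta>) ^ k * r) \<and> Q r k x"
    using response by blast
  then obtain f where f: "\<And>r k y. r > 0 \<Longrightarrow> y \<in> M \<Longrightarrow> f r k y \<in> M \<and>
      mcball (f r k y) (\<alpha> * (\<alpha> * \<beta>) ^ k * r) \<subseteq> mcball y ((\<alpha> * \<beta>) ^ k * r) \<and> Q r k (f r k y)"
    by metis
  \<comment> \<open>At turn \<open>k\<close> the list has \<open>Suc k\<close> entries, so its
    length minus one recovers the turn.\<close>
  define \<sigma> where "\<sigma> = (\<lambda>r ys. f r (length ys - 1) (last ys))"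
  have resp: "A_response \<sigma> r y k = f r k (y k)" for r y k
    by (simp add: A_response_def \<sigma>_def)
  have legal: "A_legal \<alpha> \<beta> r y (A_response \<sigma> r y) k"
    if "r > 0" "B_legal \<alpha> \<beta> r y (A_response \<sigma> r y) k" for r y k
    using that f by (auto simp: A_legal_def B_legal_def A_ball_def B_ball_def resp)
  have wins: "\<exists>z\<in>S. (\<Inter>k. B_ball \<alpha> \<beta> r y k) = {z}"
    if r: "r > 0" and B: "\<And>k. B_legal \<alpha> \<beta> r y (A_response \<sigma> r y) k" for r y
  proof -
    let ?B = "B_ball \<alpha> \<beta> r y" and ?A = "A_ball \<alpha> \<beta> r (A_response \<sigma> r y)"
    have yM: "y k \<in> M" for k
      using B[of k] by (simp add: B_legal_def)
    have BA: "?B (Suc k) \<subseteq> ?A k" for k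
      using B[of "Suc k"] by (simp add: B_legal_def)
    have AB: "?A k \<subseteq> ?B k" for k
      using legal[OF r B[of k]] by (simp add: A_legal_def)
    \<comment> \<open>The following facts are the hypotheses of Cantor's nested set criterion for
      completeness.\<close>
    have "decseq ?B"
      using BA AB by (intro decseq_SucI) blast
    moreover have "closedin mtopology (?B k)" "?B k \<noteq> {}" for k
      using yM r pos by (auto simp: B_ball_def mcball_eq_empty not_less)
    moreover have "\<exists>k p. ?B k \<subseteq> mcball p e" if e: "e > 0" for e
    proof -
      obtain k where "(\<alpha> * \<beta>) ^ k < e / r"
        using real_arch_pow_inv[of "e / r" "\<alpha> * \<beta>"] e r less by auto
      then have "(\<alpha> * \<beta>) ^ k * r \<le> e"
        using r by (simp add: pos_less_divide_eq)
      then show ?thesis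
        unfolding B_ball_def using mcball_subset_concentric by blast
    qed
    ultimately obtain z where z: "z \<in> M" "(\<Inter>k. ?B k) = {z}"
      using complete[unfolded mcomplete_nest_sing, rule_format, of ?B] by auto
    have "z \<in> ?A k" for k
      using z(2) BA[of k] by blast
    then have "z \<in> S"
      using f[OF r yM] by (intro win[OF r z(1), of "A_response \<sigma> r y"]) (simp_all add: A_ball_def resp)
    then show ?thesis
      using z(2) by blast
  qed
  have "winning_strategy \<alpha> \<beta> S \<sigma>"
    unfolding winning_strategy_def
  proof (intro allI impI conjI)
    fix r y k assume "0 < r" "\<forall>i\<le>k. B_legal \<alpha> \<beta> r y (A_response \<sigma> r y) i"
    then show "A_legal \<alpha> \<beta> r y (A_response \<sigma> r y) k"
      by (intro legal) simp_all
  next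
    fix r y assume "0 < r" "\<forall>k. B_legal \<alpha> \<beta> r y (A_response \<sigma> r y) k"
    then show "\<exists>z\<in>S. (\<Inter>k. B_ball \<alpha> \<beta> r y k) = {z}"
      by (intro wins) simp_all
  qed
  then show ?thesis
    using S by (auto simp: schmidt_winning_def)
qed

section \<open>Uniform constants and the blocks of indices\<close>

lemma exists_uniform_factor:
  fixes f g :: "nat \<Rightarrow> real"
  assumes pos: "\<And>j. f j > 0" "\<And>j. g j > 0"
    and ev: "\<forall>\<^sub>F j in sequentially. c * g j \<le> f j" "c > 0"
  shows "\<exists>\<delta>>0. \<forall>j. \<delta> * g j \<le> f j"
proof -
  obtain n where n: "\<And>j. j \<ge> n \<Longrightarrow> c * g j \<le> f j"
    using ev(1) by (auto simp: eventually_sequentially)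
  \<comment> \<open>\<open>c\<close> serves the tail and the ratios serve the finitely many early
    indices; inserting \<open>c\<close> also keeps the set nonempty when \<open>n\<close> is
    0.\<close>
  define \<delta> where "\<delta> = Min (insert c ((\<lambda>j. f j / g j) ` {..<n}))"
  have "\<delta> > 0"
    using pos ev(2) by (auto simp: \<delta>_def)
  moreover have "\<delta> * g j \<le> f j" for j
  proof (cases "j < n")
    case True
    then have "\<delta> \<le> f j / g j"
      by (auto simp: \<delta>_def intro!: Min_le)
    then show ?thesis
      using pos(2)[of j] by (simp add: pos_le_divide_eq)
  next
    case False
    have "\<delta> * g j \<le> c * g j"
      using pos(2)[of j] by (intro mult_right_mono) (auto simp: \<delta>_def intro!: Min_le)
    also have "\<dots> \<le> f j"
      using n False by simp
    finally show ?thesis .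
  qed
  ultimately show ?thesis
    by blast
qed

text \<open>The block is that of the first \<open>k\<close> with \<open>t < F k\<close>: minimality
  supplies the lower endpoint.\<close>

lemma F_block_cover:
  assumes "filterlim F at_top sequentially" "t \<ge> 0"
  shows "\<exists>k. t \<in> F_block F k"
proof -
  have "\<exists>k. t < F k"
    using assms(1) eventually_happens'[OF sequentially_bot] by (auto simp: filterlim_at_top_dense)
  then have "t < F (LEAST k. t < F k)"
    by (rule LeastI_ex)
  moreover have "F k \<le> t" if "k < (LEAST k. t < F k)" for k
    using not_less_Least[OF that] by simp
  ultimately show ?thesis
    using assms(2) by (intro exI[of _ "LEAST k. t < F k"]) (auto simp: F_block_def)
qed

text \<open>Finiteness allows the hyperplane condition, which speaks of finite lists of indices, to
  be applied to a whole block at once.\<close>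

lemma finite_F_block_vimage:
  fixes I :: "nat \<Rightarrow> real"
  assumes "filterlim I at_top sequentially"
  shows "finite {j. I j \<in> F_block F k}"
proof -
  have "\<forall>\<^sub>F j in sequentially. F k \<le> I j"
    using assms by (simp add: filterlim_at_top)
  then obtain n where n: "\<And>j. j \<ge> n \<Longrightarrow> F k \<le> I j"
    by (auto simp: eventually_sequentially)
  have "{j. I j \<in> F_block F k} \<subseteq> {..<n}"
  proof
    fix j assume "j \<in> {j. I j \<in> F_block F k}"
    then have "I j < F k"
      by (auto simp: F_block_def split: if_splits)
    then show "j \<in> {..<n}"
      using n[of j] by (auto simp: not_less[symmetric])
  qed
  then show ?thesis
    using finite_subset by blast
qed

section \<open>The winning strategy on the support\<close>

theorem theorem2p3:
  fixes \<mu> :: "(real ^ 'n) measure"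
    and K \<Omega> :: "(real ^ 'n) set"
    and r0 C D a \<alpha>' \<alpha> \<beta> :: real
    and U :: "nat \<Rightarrow> (real ^ 'n) set"
    and I F :: "nat \<Rightarrow> real"
    and \<rho> :: "real \<Rightarrow> real"
  assumes borel: "sets \<mu> = sets borel"
    and locally_finite: "locally_finite_measure \<mu>"
    and K: "K = measure_support \<mu>"
    and friendly: "absolutely_friendly \<mu> r0 C D a"
    and \<alpha>': "\<alpha>' = (D / C) powr (1 / a)"
    and \<Omega>: "\<Omega> = K"
    and I_pos: "\<And>j. I j > 0"
    and I_mono: "mono I"
    and I_lim: "filterlim I at_top sequentially"
    and \<rho>_pos: "\<And>t. t > 0 \<Longrightarrow> \<rho> t > 0"
    and \<rho>_lim: "(\<rho> \<longlongrightarrow> 0) at_top"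
    and \<rho>_decreasing: "\<exists>R. \<forall>s t. R \<le> s \<longrightarrow> s \<le> t \<longrightarrow> \<rho> t \<le> \<rho> s"
    and F_pos: "\<And>k. F k > 0"
    and F_mono: "mono F"
    and F_lim: "filterlim F at_top sequentially"
    and \<beta>: "0 < \<beta>" "\<beta> < 1"
    and \<alpha>: "0 < \<alpha>" "\<alpha> < 1 / 12 * \<alpha>'"
    and hyperplane_condition:
      "\<And>(k::nat) (l::nat) x r (j :: nat \<Rightarrow> nat).
         x \<in> K \<Longrightarrow> r \<le> r0 \<Longrightarrow> (\<And>i. i \<in> {1..l} \<Longrightarrow> I (j i) \<in> F_block F k) \<Longrightarrow>
         \<exists>L. affine_hyperplane L \<and>
             (\<Union>i\<in>{1..l}. U (j i)) \<inter> cball x ((\<alpha> * \<beta>) ^ k * r) \<subseteq> L"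
    and radius_condition: "\<And>k. (\<alpha> * \<beta>) ^ k \<ge> \<rho> (F k)"
  shows "Metric_space.schmidt_winning \<Omega> dist \<alpha> \<beta> (Bad_star U I \<rho> \<Omega>)"
proof (cases "K = {}")
  case True
  \<comment> \<open>On an empty space B has no legal first move, so the empty target is won
    vacuously.\<close>
  then have "Bad_star U I \<rho> \<Omega> = {}" "\<Omega> = {}"
    by (auto simp: Bad_star_def \<Omega>)
  moreover have "Metric_space {} (dist :: real ^ 'n \<Rightarrow> _)"
    by unfold_locales (auto simp: dist_commute dist_triangle)
  ultimately show ?thesis
    using Metric_space.schmidt_winning_empty by metis
next
  case False
  then have "D < C"
    using absolutely_friendly_consts_less[OF borel friendly] K by blast
  then have "\<alpha>' \<le> 1"
    using friendly by (auto simp: \<alpha>' absolutely_friendly_def intro!: powr_le1)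
  then have \<alpha>_small: "\<alpha> \<le> 1 / 12"
    using \<alpha>(2) by simp
  have "\<alpha> * \<beta> < 1 * 1"
    using \<alpha> \<beta> \<alpha>_small by (intro mult_strict_mono) auto
  then have q: "0 < \<alpha> * \<beta>" "\<alpha> * \<beta> < 1"
    using \<alpha> \<beta> by auto
  have r0: "r0 > 0"
    using friendly by (simp add: absolutely_friendly_def)

  \<comment> \<open>The balls of the game are traces on \<open>K\<close> of Euclidean balls, so
    Euclidean inclusions carry over to the game; completeness comes from the closedness of the
    support.\<close>
  interpret KM: Submetric UNIV "dist :: real ^ 'n \<Rightarrow> _" K
    by (rule Submetric.intro) (simp_all add: Met_TC.Metric_space_axioms Submetric_axioms_def)
  have mcball: "KM.sub.mcball y s = (if y \<in> K then K \<inter> cball y s else {})" for y s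
    by (auto simp: KM.sub.mcball_def)
  have complete: "KM.sub.mcomplete"
    using closed_measure_support[of \<mu>]
    by (intro KM.closedin_mcomplete_imp_mcomplete) (simp_all add: K complete_UNIV)

  have block_in_hyperplane: "\<exists>L. affine_hyperplane L \<and>
      (\<Union>j\<in>{j. I j \<in> F_block F k}. U j) \<inter> cball y ((\<alpha> * \<beta>) ^ k * s) \<subseteq> L"
    if "y \<in> K" "s \<le> r0" for k y s
  proof -
    let ?J = "{j. I j \<in> F_block F k}"
    \<comment> \<open>An enumeration of the block from 1 to its cardinality; for an empty block this
      is the case \<open>l = 0\<close> of the condition.\<close>
    obtain h where "bij_betw h {1..card ?J} ?J"
      using ex_bij_betw_nat_finite_1[OF finite_F_block_vimage[OF I_lim]] by blast
    then have "h ` {1..card ?J} = ?J"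
      by (rule bij_betw_imp_surj_on)
    then show ?thesis
      using hyperplane_condition[OF that, of "card ?J" h k]
      by (metis (no_types, lifting) SUP_image comp_apply image_cong imageI mem_Collect_eq)
  qed

  define m where "m r = (LEAST i. (\<alpha> * \<beta>) ^ i * r \<le> r0)" for r
  have m: "(\<alpha> * \<beta>) ^ m r * r \<le> r0" if r: "r > 0" for r
  proof -
    obtain i where "(\<alpha> * \<beta>) ^ i < r0 / r"
      using real_arch_pow_inv[of "r0 / r" "\<alpha> * \<beta>"] r r0 q by auto
    then have "(\<alpha> * \<beta>) ^ i * r \<le> r0"
      using r by (simp add: pos_less_divide_eq)
    then show ?thesis
      unfolding m_def by (rule LeastI)
  qed

  \<comment> \<open>The hyperplane condition speaks of radii \<open>(\<alpha>\<beta>)\<^sup>k s\<close> with \<open>s \<le> r0\<close>, but B may start with a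
    larger radius; A therefore only starts dodging at turn \<open>m r\<close>, and treats block \<open>k\<close> at turn \<open>m r + k\<close>.\<close>
  define Q where "Q r n x \<longleftrightarrow> (n \<ge> m r \<longrightarrow>
      (\<forall>p\<in>cball x (\<alpha> * (\<alpha> * \<beta>) ^ n * r). \<forall>j. I j \<in> F_block F (n - m r) \<longrightarrow>
        (\<forall>u\<in>U j. \<alpha> * (\<alpha> * \<beta>) ^ n * r \<le> dist p u)))" for r n x
  have response: "\<exists>x\<in>K. cball x (\<alpha> * (\<alpha> * \<beta>) ^ n * r) \<subseteq> cball y ((\<alpha> * \<beta>) ^ n * r) \<and> Q r n x"
    if r: "r > 0" and y: "y \<in> K" for r n y
  proof (cases "n \<ge> m r")
    case True
    define k where "k = n - m r"
    define s where "s = (\<alpha> * \<beta>) ^ n * r"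
    \<comment> \<open>This factorisation matches the hyperplane condition at index \<open>k\<close>
      with radius parameter \<open>(\<alpha> * \<beta>) ^ m r * r\<close>, which is at most
      \<open>r0\<close>.\<close>
    have s_eq: "s = (\<alpha> * \<beta>) ^ k * ((\<alpha> * \<beta>) ^ m r * r)"
      using True by (simp add: s_def k_def flip: power_add mult.assoc)
    have "(\<alpha> * \<beta>) ^ k \<le> 1"
      using q by (intro power_le_one) auto
    then have "s \<le> (\<alpha> * \<beta>) ^ m r * r"
      unfolding s_eq using q r by (intro mult_left_le_one_le) auto
    also have "\<dots> \<le> r0"
      by (rule m[OF r])
    finally have s: "0 < s" "s \<le> r0"
      using q(1) r by (simp_all add: s_def)
    obtain L where L: "affine_hyperplane L" "(\<Union>j\<in>{j. I j \<in> F_block F k}. U j) \<inter> cball y s \<subseteq> L"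
      using block_in_hyperplane[OF y m[OF r], of k] unfolding s_eq by blast
    obtain x where "x \<in> K" "cball x (\<alpha> * s) \<subseteq> cball y s"
      "\<And>p j u. p \<in> cball x (\<alpha> * s) \<Longrightarrow> I j \<in> F_block F k \<Longrightarrow> u \<in> U j \<Longrightarrow> \<alpha> * s \<le> dist p u"
      using exists_ball_avoiding_hyperplane[OF borel friendly _ _ \<alpha>_small _ s L] \<alpha> \<alpha>' y K by blast
    then show ?thesis
      by (intro bexI[of _ x]) (auto simp: Q_def s_def k_def mult.assoc)
  next
    case False
    \<comment> \<open>Before turn \<open>m r\<close> nothing has to be avoided, and A simply keeps
      B's centre.\<close>
    have "\<alpha> * ((\<alpha> * \<beta>) ^ n * r) \<le> 1 * ((\<alpha> * \<beta>) ^ n * r)"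
      using \<alpha>_small q r by (intro mult_right_mono) auto
    then have "cball y (\<alpha> * (\<alpha> * \<beta>) ^ n * r) \<subseteq> cball y ((\<alpha> * \<beta>) ^ n * r)"
      by (intro subset_cball) (simp add: mult.assoc)
    then show ?thesis
      using y False unfolding Q_def by blast
  qed

  have win: "z \<in> Bad_star U I \<rho> \<Omega>"
    if r: "r > 0" and z: "z \<in> K" and zx: "\<And>n. z \<in> cball (x n) (\<alpha> * (\<alpha> * \<beta>) ^ n * r)"
      and Q: "\<And>n. Q r n (x n)" for r x z
  proof -
    \<comment> \<open>\<open>c\<close> is the radius of A's ball at turn \<open>m r\<close>. Hence
      \<open>f j\<close> below is the radius of A's ball at turn \<open>m r + b j\<close>, where the
      block of \<open>I j\<close> is avoided.\<close>
    define c where "c = \<alpha> * (\<alpha> * \<beta>) ^ m r * r"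
    have c: "c > 0"
      using \<alpha> q r by (simp add: c_def)
    have "\<exists>k. I j \<in> F_block F k" for j
      using F_block_cover[OF F_lim] I_pos[of j] by simp
    then obtain b where b: "\<And>j. I j \<in> F_block F (b j)"
      by metis
    define f where "f j = (\<alpha> * \<beta>) ^ b j * c" for j
    have f_le: "f j \<le> dist z u" if "u \<in> U j" for j u
    proof -
      have "\<alpha> * (\<alpha> * \<beta>) ^ (m r + b j) * r \<le> dist z u"
        using Q[of "m r + b j"] zx[of "m r + b j"] b[of j] that unfolding Q_def by simp
      then show ?thesis
        by (simp add: f_def c_def power_add mult_ac)
    qed
    obtain R where R: "\<And>s t. R \<le> s \<Longrightarrow> s \<le> t \<Longrightarrow> \<rho> t \<le> \<rho> s"
      using \<rho>_decreasing by blast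
    obtain k0 where k0: "R \<le> F k0"
      using F_lim eventually_happens'[OF sequentially_bot] by (auto simp: filterlim_at_top)
    \<comment> \<open>Such a \<open>j\<close> lies in a block whose lower endpoint
      \<open>F (b j - 1)\<close> is at least \<open>R\<close>, so \<rho> decreases from there to
      \<open>I j\<close>. The radius condition thus enters at index \<open>b j - 1\<close>, and the
      extra factor \<open>\<alpha> * \<beta>\<close> pays for the shift by one.\<close>
    have "(c * (\<alpha> * \<beta>)) * \<rho> (I j) \<le> f j" if j: "F (Suc k0) \<le> I j" for j
    proof -
      have less: "I j < F (b j)" and ge: "b j > 0 \<Longrightarrow> F (b j - 1) \<le> I j"
        using b[of j] by (auto simp: F_block_def split: if_splits)
      have "Suc k0 < b j"
        using less j F_mono by (metis le_less_trans leD leI monoD)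
      then have "F k0 \<le> F (b j - 1)"
        by (intro monoD[OF F_mono]) simp
      then have "R \<le> F (b j - 1)"
        using k0 by simp
      then have "\<rho> (I j) \<le> (\<alpha> * \<beta>) ^ (b j - 1)"
        using R ge \<open>Suc k0 < b j\<close> radius_condition[of "b j - 1"] by (meson order_trans Suc_lessD zero_less_Suc less_trans)
      then have "(c * (\<alpha> * \<beta>)) * \<rho> (I j) \<le> (c * (\<alpha> * \<beta>)) * (\<alpha> * \<beta>) ^ (b j - 1)"
        using c q by (intro mult_left_mono) auto
      also have "\<dots> = f j"
        using \<open>Suc k0 < b j\<close> by (cases "b j") (auto simp: f_def)
      finally show ?thesis .
    qed
    moreover have "\<forall>\<^sub>F j in sequentially. F (Suc k0) \<le> I j"
      using I_lim by (simp add: filterlim_at_top)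
    ultimately have "\<forall>\<^sub>F j in sequentially. (c * (\<alpha> * \<beta>)) * \<rho> (I j) \<le> f j"
      by (auto elim: eventually_mono)
    \<comment> \<open>The early indices can be absorbed because A avoided their blocks too, so that
      \<open>f j\<close> is positive for every \<open>j\<close>.\<close>
    then obtain \<delta> where "\<delta> > 0" and \<delta>: "\<And>j. \<delta> * \<rho> (I j) \<le> f j"
      using exists_uniform_factor[of f "\<lambda>j. \<rho> (I j)" "c * (\<alpha> * \<beta>)"] c q \<rho>_pos I_pos
      by (auto simp: f_def)
    have "ereal (\<delta> * \<rho> (I j)) \<le> set_dist {z} (U j)" for j
      unfolding set_dist_singleton using \<delta>[of j] f_le
      by (intro INF_greatest) (auto intro: order_trans)
    then show ?thesis
      using z \<open>\<delta> > 0\<close> by (auto simp: Bad_star_def \<Omega>)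
  qed

  have "KM.sub.schmidt_winning \<alpha> \<beta> (Bad_star U I \<rho> \<Omega>)"
  proof (rule KM.sub.schmidt_winning_if_responses[OF complete _ \<alpha>(1) \<beta>(1) q(2), where Q = Q])
    show "Bad_star U I \<rho> \<Omega> \<subseteq> K"
      by (auto simp: Bad_star_def \<Omega>)
  next
    fix r :: real and n y assume "r > 0" "y \<in> K"
    then show "\<exists>x\<in>K. KM.sub.mcball x (\<alpha> * (\<alpha> * \<beta>) ^ n * r) \<subseteq> KM.sub.mcball y ((\<alpha> * \<beta>) ^ n * r) \<and> Q r n x"
      using response[of r y n] by (auto simp: mcball)
  next
    fix r :: real and x z
    assume *: "r > 0" "z \<in> K" "\<And>n. z \<in> KM.sub.mcball (x n) (\<alpha> * (\<alpha> * \<beta>) ^ n * r)" "\<And>n. Q r n (x n)"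
    have "z \<in> cball (x n) (\<alpha> * (\<alpha> * \<beta>) ^ n * r)" for n
      using *(3)[of n] by simp
    then show "z \<in> Bad_star U I \<rho> \<Omega>"
      using *(1,2,4) by (intro win)
  qed
  then show ?thesis
    by (simp add: \<Omega>)
qed

end
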